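(* (1) Let $(V,\mu,\nu)$ be a unital associative algebra in a symmetric category $(\mathcal{C},\otimes,\mathbf{I},c)$, and let $\sigma_{V,\mu}:=\nu\otimes\mu:V\otimes V=\mathbf{I}\otimes V\otimes V\to V\otimes V$. Then the pair $(c_{V,V},\sigma_{V,\mu})$ defines a $VB_n^+$ action. (2) Let $(V,[,],\nu)$ be a unital Leibniz algebra in a symmetric preadditive category $(\mathcal{C},\otimes,\mathbf{I},c)$, and let $\sigma_{V,[,]}:=c_{V,V}+\nu\otimes[,]:V\otimes V\to V\otimes V$. Then the pair $(c_{V,V},\sigma_{V,[,]})$ defines a $VB_n$ action.
   Context: All monoidal categories are strict; a symmetric category is a strict symmetric monoidal category; a symmetric preadditive category is a symmetric category which is preadditive, with $\otimes$ bilinear on morphisms. A unital associative algebra in a monoidal category is an object $V$ with $\mu:V\otimes V\to V$, $\nu:\mathbf{I}\to V$ satisfying $\mu\circ(\operatorname{Id}_V\otimes\mu)=\mu\circ(\mu\otimes\operatorname{Id}_V)$ and $\mu\circ(\operatorname{Id}_V\otimes\nu)=\mu\circ(\nu\otimes\operatorname{Id}_V)=\operatorname{Id}_V$. A unital Leibniz algebra in a symmetric preadditive category is an object $V$ with $[,]:V\otimes V\to V$, $\nu:\mathbf{I}\to V$ satisfying $[,]\circ(\operatorname{Id}_V\otimes[,])=[,]\circ([,]\otimes\operatorname{Id}_V)-[,]\circ([,]\otimes\operatorname{Id}_V)\circ(\operatorname{Id}_V\otimes c_{V,V}):V^{\otimes3}\to V$ and $[,]\circ(\operatorname{Id}_V\otimes\nu)=[,]\circ(\nu\otimes\operatorname{Id}_V)=0$.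 The virtual braid group $VB_n$ is the group with generators $\sigma_i,\zeta_i$ $(1\le i\le n-1)$ and relations: $\sigma_i\sigma_j=\sigma_j\sigma_i$, $\zeta_i\zeta_j=\zeta_j\zeta_i$, $\sigma_i\zeta_j=\zeta_j\sigma_i$ for $|i-j|>1$; $\zeta_i^2=1$; $\sigma_i\sigma_{i+1}\sigma_i=\sigma_{i+1}\sigma_i\sigma_{i+1}$, $\zeta_i\zeta_{i+1}\zeta_i=\zeta_{i+1}\zeta_i\zeta_{i+1}$, $\zeta_i\zeta_{i+1}\sigma_i=\sigma_{i+1}\zeta_i\zeta_{i+1}$ for $1\le i\le n-2$. The positive virtual braid monoid $VB_n^+$ is the monoid with the same generators and relations. For $\varphi:V\otimes V\to V\otimes V$ put $\varphi_i:=\operatorname{Id}_V^{\otimes(i-1)}\otimes\varphi\otimes\operatorname{Id}_V^{\otimes(n-i-1)}$. A pair $(\xi,\vartheta)$ of endomorphisms of $V\otimes V$ defines a $VB_n$ (resp. $VB_n^+$) action if for every $n$ the assignments $\zeta_i\mapsto\xi_i$, $\sigma_i\mapsto\vartheta_i$ define an action of $VB_n$ (resp. $VB_n^+$) on $V^{\otimes n}$, i.e. a group (resp. monoid) homomorphism to $\operatorname{Aut}_{\mathcal{C}}(V^{\otimes n})$ (resp. $\operatorname{End}_{\mathcal{C}}(V^{\otimes n})$). *)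

theory Defs
  imports "HOL-Algebra.Group"
begin

section \<open>Strict symmetric categories\<close>

record ('o, 'm) category_data =
  Obj :: "'o set"
  Arr :: "'m set"
  Dom :: "'m \<Rightarrow> 'o"
  Cod :: "'m \<Rightarrow> 'o"
  Comp :: "'m \<Rightarrow> 'm \<Rightarrow> 'm"  (infixl \<open>\<cdot>\<index>\<close> 70)
  Ident :: "'o \<Rightarrow> 'm"

text \<open>Composition is written in the usual order: \<open>g \<cdot> f\<close> is ``first \<open>f\<close>, then \<open>g\<close>''.\<close>

definition Hom :: "('o, 'm, 'x) category_data_scheme \<Rightarrow> 'o \<Rightarrow> 'o \<Rightarrow> 'm set" where
  "Hom C X Y = {f \<in> Arr C. Dom C f = X \<and> Cod C f = Y}"

record ('o, 'm) symmetric_data = "('o, 'm) category_data" +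
  Tobj :: "'o \<Rightarrow> 'o \<Rightarrow> 'o"  (infixr \<open>\<odot>\<index>\<close> 75)
  Tarr :: "'m \<Rightarrow> 'm \<Rightarrow> 'm"  (infixr \<open>\<boxtimes>\<index>\<close> 75)
  Tunit :: 'o
  Symm :: "'o \<Rightarrow> 'o \<Rightarrow> 'm"

locale category =
  fixes C (structure)
  assumes Dom_Obj: "f \<in> Arr C \<Longrightarrow> Dom C f \<in> Obj C"
    and Cod_Obj: "f \<in> Arr C \<Longrightarrow> Cod C f \<in> Obj C"
    and Ident_Hom: "X \<in> Obj C \<Longrightarrow> Ident C X \<in> Hom C X X"
    and Comp_Hom: "\<lbrakk>f \<in> Hom C X Y; g \<in> Hom C Y Z\<rbrakk> \<Longrightarrow> g \<cdot> f \<in> Hom C X Z"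
    and Comp_Ident: "f \<in> Hom C X Y \<Longrightarrow> f \<cdot> Ident C X = f"
    and Ident_Comp: "f \<in> Hom C X Y \<Longrightarrow> Ident C Y \<cdot> f = f"
    and Comp_assoc: "\<lbrakk>f \<in> Hom C X Y; g \<in> Hom C Y Z; h \<in> Hom C Z W\<rbrakk>
        \<Longrightarrow> (h \<cdot> g) \<cdot> f = h \<cdot> (g \<cdot> f)"

locale strict_monoidal_category = category C
  for C :: "('o, 'm, 'x) symmetric_data_scheme" (structure) +
  assumes Tunit_Obj: "Tunit C \<in> Obj C"
    and Tobj_Obj: "\<lbrakk>X \<in> Obj C; Y \<in> Obj C\<rbrakk> \<Longrightarrow> X \<odot> Y \<in> Obj C"
    and Tarr_Hom: "\<lbrakk>f \<in> Hom C X X'; g \<in> Hom C Y Y'\<rbrakk> \<Longrightarrow> f \<boxtimes> g \<in> Hom C (X \<odot> Y) (X' \<odot> Y')"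
    and Tarr_Ident: "\<lbrakk>X \<in> Obj C; Y \<in> Obj C\<rbrakk> \<Longrightarrow> Ident C X \<boxtimes> Ident C Y = Ident C (X \<odot> Y)"
    and Tarr_Comp: "\<lbrakk>f \<in> Hom C X Y; g \<in> Hom C Y Z; f' \<in> Hom C X' Y'; g' \<in> Hom C Y' Z'\<rbrakk>
        \<Longrightarrow> (g \<cdot> f) \<boxtimes> (g' \<cdot> f') = (g \<boxtimes> g') \<cdot> (f \<boxtimes> f')"
    and Tobj_assoc: "\<lbrakk>X \<in> Obj C; Y \<in> Obj C; Z \<in> Obj C\<rbrakk> \<Longrightarrow> (X \<odot> Y) \<odot> Z = X \<odot> (Y \<odot> Z)"
    and Tobj_unit_left: "X \<in> Obj C \<Longrightarrow> Tunit C \<odot> X = X"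
    and Tobj_unit_right: "X \<in> Obj C \<Longrightarrow> X \<odot> Tunit C = X"
    and Tarr_assoc: "\<lbrakk>f \<in> Arr C; g \<in> Arr C; h \<in> Arr C\<rbrakk> \<Longrightarrow> (f \<boxtimes> g) \<boxtimes> h = f \<boxtimes> (g \<boxtimes> h)"
    and Tarr_unit_left: "f \<in> Arr C \<Longrightarrow> Ident C (Tunit C) \<boxtimes> f = f"
    and Tarr_unit_right: "f \<in> Arr C \<Longrightarrow> f \<boxtimes> Ident C (Tunit C) = f"

locale symmetric_category = strict_monoidal_category C
  for C :: "('o, 'm, 'x) symmetric_data_scheme" (structure) +
  assumes Symm_Hom: "\<lbrakk>X \<in> Obj C; Y \<in> Obj C\<rbrakk> \<Longrightarrow> Symm C X Y \<in> Hom C (X \<odot> Y) (Y \<odot> X)"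
    and Symm_natural: "\<lbrakk>f \<in> Hom C X X'; g \<in> Hom C Y Y'\<rbrakk>
        \<Longrightarrow> Symm C X' Y' \<cdot> (f \<boxtimes> g) = (g \<boxtimes> f) \<cdot> Symm C X Y"
    and Symm_inverse: "\<lbrakk>X \<in> Obj C; Y \<in> Obj C\<rbrakk> \<Longrightarrow> Symm C Y X \<cdot> Symm C X Y = Ident C (X \<odot> Y)"
    and Symm_hexagon_left: "\<lbrakk>X \<in> Obj C; Y \<in> Obj C; Z \<in> Obj C\<rbrakk>
        \<Longrightarrow> Symm C (X \<odot> Y) Z = (Symm C X Z \<boxtimes> Ident C Y) \<cdot> (Ident C X \<boxtimes> Symm C Y Z)"
    and Symm_hexagon_right: "\<lbrakk>X \<in> Obj C; Y \<in> Obj C; Z \<in> Obj C\<rbrakk>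
        \<Longrightarrow> Symm C X (Y \<odot> Z) = (Ident C Y \<boxtimes> Symm C X Z) \<cdot> (Symm C X Y \<boxtimes> Ident C Z)"

record ('o, 'm) preadditive_data = "('o, 'm) symmetric_data" +
  Hadd :: "'m \<Rightarrow> 'm \<Rightarrow> 'm"
  Hzero :: "'o \<Rightarrow> 'o \<Rightarrow> 'm"

definition Hom_group :: "('o, 'm, 'x) preadditive_data_scheme \<Rightarrow> 'o \<Rightarrow> 'o \<Rightarrow> 'm monoid" where
  "Hom_group C X Y = \<lparr>carrier = Hom C X Y, mult = Hadd C, one = Hzero C X Y\<rparr>"

definition Hdiff :: "('o, 'm, 'x) preadditive_data_scheme \<Rightarrow> 'm \<Rightarrow> 'm \<Rightarrow> 'm" where
  "Hdiff C f g = Hadd C f (inv\<^bsub>Hom_group C (Dom C g) (Cod C g)\<^esub> g)"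

locale symmetric_preadditive_category = symmetric_category C
  for C :: "('o, 'm, 'x) preadditive_data_scheme" (structure) +
  assumes Hom_comm_group: "\<lbrakk>X \<in> Obj C; Y \<in> Obj C\<rbrakk> \<Longrightarrow> comm_group (Hom_group C X Y)"
    and Comp_Hadd_right: "\<lbrakk>f \<in> Hom C X Y; f' \<in> Hom C X Y; g \<in> Hom C Y Z\<rbrakk>
        \<Longrightarrow> g \<cdot> Hadd C f f' = Hadd C (g \<cdot> f) (g \<cdot> f')"
    and Comp_Hadd_left: "\<lbrakk>f \<in> Hom C X Y; g \<in> Hom C Y Z; g' \<in> Hom C Y Z\<rbrakk>
        \<Longrightarrow> Hadd C g g' \<cdot> f = Hadd C (g \<cdot> f) (g' \<cdot> f)"
    and Tarr_Hadd_right: "\<lbrakk>f \<in> Hom C X X'; g \<in> Hom C Y Y'; g' \<in> Hom C Y Y'\<rbrakk>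
        \<Longrightarrow> f \<boxtimes> Hadd C g g' = Hadd C (f \<boxtimes> g) (f \<boxtimes> g')"
    and Tarr_Hadd_left: "\<lbrakk>f \<in> Hom C X X'; f' \<in> Hom C X X'; g \<in> Hom C Y Y'\<rbrakk>
        \<Longrightarrow> Hadd C f f' \<boxtimes> g = Hadd C (f \<boxtimes> g) (f' \<boxtimes> g)"

section \<open>Algebras in a category\<close>

definition unital_associative_algebra ::
    "('o, 'm, 'x) symmetric_data_scheme \<Rightarrow> 'o \<Rightarrow> 'm \<Rightarrow> 'm \<Rightarrow> bool" where
  "unital_associative_algebra C V mu nu \<longleftrightarrow>
     V \<in> Obj C \<and> mu \<in> Hom C (V \<odot>\<^bsub>C\<^esub> V) V \<and> nu \<in> Hom C (Tunit C) V \<and>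
     mu \<cdot>\<^bsub>C\<^esub> (Ident C V \<boxtimes>\<^bsub>C\<^esub> mu) = mu \<cdot>\<^bsub>C\<^esub> (mu \<boxtimes>\<^bsub>C\<^esub> Ident C V) \<and>
     mu \<cdot>\<^bsub>C\<^esub> (Ident C V \<boxtimes>\<^bsub>C\<^esub> nu) = Ident C V \<and>
     mu \<cdot>\<^bsub>C\<^esub> (nu \<boxtimes>\<^bsub>C\<^esub> Ident C V) = Ident C V"

definition unital_Leibniz_algebra ::
    "('o, 'm, 'x) preadditive_data_scheme \<Rightarrow> 'o \<Rightarrow> 'm \<Rightarrow> 'm \<Rightarrow> bool" where
  "unital_Leibniz_algebra C V br nu \<longleftrightarrow>
     V \<in> Obj C \<and> br \<in> Hom C (V \<odot>\<^bsub>C\<^esub> V) V \<and> nu \<in> Hom C (Tunit C) V \<and>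
     br \<cdot>\<^bsub>C\<^esub> (Ident C V \<boxtimes>\<^bsub>C\<^esub> br) =
       Hdiff C (br \<cdot>\<^bsub>C\<^esub> (br \<boxtimes>\<^bsub>C\<^esub> Ident C V))
         (br \<cdot>\<^bsub>C\<^esub> (br \<boxtimes>\<^bsub>C\<^esub> Ident C V) \<cdot>\<^bsub>C\<^esub> (Ident C V \<boxtimes>\<^bsub>C\<^esub> Symm C V V)) \<and>
     br \<cdot>\<^bsub>C\<^esub> (Ident C V \<boxtimes>\<^bsub>C\<^esub> nu) = Hzero C V V \<and>
     br \<cdot>\<^bsub>C\<^esub> (nu \<boxtimes>\<^bsub>C\<^esub> Ident C V) = Hzero C V V"

section \<open>Monoids and groups given by generators and relations\<close>

inductive word_cong :: "'g set \<Rightarrow> ('g list \<times> 'g list) set \<Rightarrow> 'g list \<Rightarrow> 'g list \<Rightarrow> bool"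
  for X R where
  word_cong_rel: "\<lbrakk>(u, v) \<in> R; u \<in> lists X; v \<in> lists X; a \<in> lists X; b \<in> lists X\<rbrakk>
      \<Longrightarrow> word_cong X R (a @ u @ b) (a @ v @ b)"
| word_cong_refl: "w \<in> lists X \<Longrightarrow> word_cong X R w w"
| word_cong_sym: "word_cong X R u v \<Longrightarrow> word_cong X R v u"
| word_cong_trans: "\<lbrakk>word_cong X R u v; word_cong X R v w\<rbrakk> \<Longrightarrow> word_cong X R u w"

definition word_class :: "'g set \<Rightarrow> ('g list \<times> 'g list) set \<Rightarrow> 'g list \<Rightarrow> 'g list set" where
  "word_class X R w = {w'. word_cong X R w w'}"

definition presented_monoid :: "'g set \<Rightarrow> ('g list \<times> 'g list) set \<Rightarrow> 'g list set monoid" where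
  "presented_monoid X R =
     \<lparr>carrier = word_class X R ` lists X,
      mult = (\<lambda>A B. \<Union>u\<in>A. \<Union>v\<in>B. word_class X R (u @ v)),
      one = word_class X R []\<rparr>"

text \<open>In a group presentation the letters are signed generators: \<open>(x, True)\<close> stands for \<open>x\<close> and
  \<open>(x, False)\<close> for its inverse.\<close>

definition group_letters :: "'g set \<Rightarrow> ('g \<times> bool) set" where
  "group_letters X = X \<times> UNIV"

definition positive_word :: "'g list \<Rightarrow> ('g \<times> bool) list" where
  "positive_word = map (\<lambda>x. (x, True))"

definition group_relations ::
    "'g set \<Rightarrow> ('g list \<times> 'g list) set \<Rightarrow> (('g \<times> bool) list \<times> ('g \<times> bool) list) set" where
  "group_relations X R =
     {(positive_word u, positive_word v) | u v. (u, v) \<in> R} \<union>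
     {([(x, e), (x, \<not> e)], []) | x e. x \<in> X}"

definition presented_group ::
    "'g set \<Rightarrow> ('g list \<times> 'g list) set \<Rightarrow> ('g \<times> bool) list set monoid" where
  "presented_group X R = presented_monoid (group_letters X) (group_relations X R)"

lemma word_cong_lists: "word_cong X R u v \<Longrightarrow> u \<in> lists X \<and> v \<in> lists X"
  by (induction rule: word_cong.induct) auto

lemma word_class_eq_iff:
  "u \<in> lists X \<Longrightarrow> word_class X R u = word_class X R v \<longleftrightarrow> word_cong X R u v"
  unfolding word_class_def set_eq_iff mem_Collect_eq
  by (metis word_cong_refl word_cong_sym word_cong_trans)

lemma word_cong_append_left:
  "word_cong X R u v \<Longrightarrow> c \<in> lists X \<Longrightarrow> word_cong X R (c @ u) (c @ v)"
proof (induction rule: word_cong.induct)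
  case (word_cong_rel u v a b)
  then show ?case using word_cong.word_cong_rel[of u v R X "c @ a" b] by auto
next
  case (word_cong_refl w)
  then show ?case by (simp add: word_cong.word_cong_refl)
next
  case (word_cong_sym u v)
  then show ?case by (simp add: word_cong.word_cong_sym)
next
  case (word_cong_trans u v w)
  then show ?case by (metis word_cong.word_cong_trans)
qed

lemma word_cong_append_right:
  "word_cong X R u v \<Longrightarrow> c \<in> lists X \<Longrightarrow> word_cong X R (u @ c) (v @ c)"
proof (induction rule: word_cong.induct)
  case (word_cong_rel u v a b)
  then show ?case using word_cong.word_cong_rel[of u v R X a "b @ c"] by auto
next
  case (word_cong_refl w)
  then show ?case by (simp add: word_cong.word_cong_refl)
next
  case (word_cong_sym u v)
  then show ?case by (simp add: word_cong.word_cong_sym)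
next
  case (word_cong_trans u v w)
  then show ?case by (metis word_cong.word_cong_trans)
qed

lemma word_cong_append:
  "word_cong X R u u' \<Longrightarrow> word_cong X R v v' \<Longrightarrow> word_cong X R (u @ v) (u' @ v')"
  by (meson word_cong_append_left word_cong_append_right word_cong_lists word_cong_trans)

lemma presented_monoid_mult:
  assumes "u \<in> lists X" "v \<in> lists X"
  shows "word_class X R u \<otimes>\<^bsub>presented_monoid X R\<^esub> word_class X R v = word_class X R (u @ v)"
proof -
  have "word_class X R (u' @ v') = word_class X R (u @ v)"
    if "u' \<in> word_class X R u" "v' \<in> word_class X R v" for u' v'
  proof -
    have "word_cong X R (u @ v) (u' @ v')"
      using that by (simp add: word_class_def word_cong_append)
    then show ?thesis using assms word_class_eq_iff[of "u @ v" X R "u' @ v'"] by simp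
  qed
  moreover have "u \<in> word_class X R u" "v \<in> word_class X R v"
    using assms by (auto simp: word_class_def intro: word_cong_refl)
  ultimately have "(\<Union>u'\<in>word_class X R u. \<Union>v'\<in>word_class X R v. word_class X R (u' @ v')) =
      word_class X R (u @ v)"
    by (intro equalityI UN_least) (metis order_refl, blast)
  then show ?thesis unfolding presented_monoid_def by simp
qed

lemma monoid_presented_monoid: "monoid (presented_monoid X R)"
proof (rule monoidI)
  show "\<one>\<^bsub>presented_monoid X R\<^esub> \<in> carrier (presented_monoid X R)"
    by (auto simp: presented_monoid_def)
next
  fix A B
  assume "A \<in> carrier (presented_monoid X R)" "B \<in> carrier (presented_monoid X R)"
  then obtain u v where "u \<in> lists X" "v \<in> lists X" "A = word_class X R u" "B = word_class X R v"
    by (auto simp: presented_monoid_def)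
  then show "A \<otimes>\<^bsub>presented_monoid X R\<^esub> B \<in> carrier (presented_monoid X R)"
    by (simp only: presented_monoid_mult) (auto simp: presented_monoid_def)
next
  fix A B D
  assume "A \<in> carrier (presented_monoid X R)" "B \<in> carrier (presented_monoid X R)"
    "D \<in> carrier (presented_monoid X R)"
  then obtain u v w where "u \<in> lists X" "v \<in> lists X" "w \<in> lists X"
      "A = word_class X R u" "B = word_class X R v" "D = word_class X R w"
    by (auto simp: presented_monoid_def)
  then show "A \<otimes>\<^bsub>presented_monoid X R\<^esub> B \<otimes>\<^bsub>presented_monoid X R\<^esub> D =
      A \<otimes>\<^bsub>presented_monoid X R\<^esub> (B \<otimes>\<^bsub>presented_monoid X R\<^esub> D)"
    by (simp only: presented_monoid_mult append_in_lists_conv simp_thms append_assoc)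
next
  fix A
  assume "A \<in> carrier (presented_monoid X R)"
  then obtain u where u: "u \<in> lists X" "A = word_class X R u"
    by (auto simp: presented_monoid_def)
  have one: "\<one>\<^bsub>presented_monoid X R\<^esub> = word_class X R []"
    by (simp add: presented_monoid_def)
  show "\<one>\<^bsub>presented_monoid X R\<^esub> \<otimes>\<^bsub>presented_monoid X R\<^esub> A = A"
    "A \<otimes>\<^bsub>presented_monoid X R\<^esub> \<one>\<^bsub>presented_monoid X R\<^esub> = A"
    unfolding one u(2) using u(1) by (simp_all add: presented_monoid_mult)
qed

lemma group_presented_group: "group (presented_group X R)"
proof -
  let ?X = "group_letters X" and ?R = "group_relations X R"
  interpret monoid "presented_group X R"
    unfolding presented_group_def by (rule monoid_presented_monoid)
  have inv: "\<exists>v \<in> lists ?X. word_cong ?X ?R (v @ u) []" if "u \<in> lists ?X" for u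
    using that
  proof (induction u)
    case Nil
    then show ?case by (auto intro: word_cong_refl)
  next
    case (Cons y u)
    then obtain v where v: "v \<in> lists ?X" "word_cong ?X ?R (v @ u) []" by auto
    obtain x e where y: "y = (x, e)" "x \<in> X" using Cons.hyps by (auto simp: group_letters_def)
    have "([(x, \<not> e), (x, \<not> \<not> e)], []) \<in> ?R" using y(2) unfolding group_relations_def by blast
    then have "word_cong ?X ?R (v @ [(x, \<not> e), y] @ u) (v @ [] @ u)"
      using y v Cons by (intro word_cong_rel) (auto simp: group_letters_def)
    then have "word_cong ?X ?R ((v @ [(x, \<not> e)]) @ (y # u)) []"
      using word_cong_trans[OF _ v(2)] by simp
    moreover have "v @ [(x, \<not> e)] \<in> lists ?X" using v y by (auto simp: group_letters_def)
    ultimately show ?case by blast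
  qed
  show ?thesis
  proof (rule group_l_invI)
    fix A
    assume "A \<in> carrier (presented_group X R)"
    then obtain u where u: "u \<in> lists ?X" "A = word_class ?X ?R u"
      by (auto simp: presented_group_def presented_monoid_def)
    obtain v where v: "v \<in> lists ?X" "word_cong ?X ?R (v @ u) []" using inv[OF u(1)] by auto
    have "word_class ?X ?R v \<otimes>\<^bsub>presented_group X R\<^esub> A = word_class ?X ?R []"
      using u v by (simp add: presented_group_def presented_monoid_mult word_class_eq_iff)
    then show "\<exists>B \<in> carrier (presented_group X R).
        B \<otimes>\<^bsub>presented_group X R\<^esub> A = \<one>\<^bsub>presented_group X R\<^esub>"
      using v(1) by (auto simp: presented_group_def presented_monoid_def)
  qed
qed

section \<open>Virtual braid groups and monoids\<close>

datatype vb_gen = Sg nat | Zt nat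

definition VB_gens :: "nat \<Rightarrow> vb_gen set" where
  "VB_gens n = {Sg i | i. 1 \<le> i \<and> i < n} \<union> {Zt i | i. 1 \<le> i \<and> i < n}"

text \<open>\<open>far n i j\<close>: both indices lie in \<open>{1..n-1}\<close> and \<open>\<bar>i - j\<bar> > 1\<close>.\<close>

definition far :: "nat \<Rightarrow> nat \<Rightarrow> nat \<Rightarrow> bool" where
  "far n i j \<longleftrightarrow> 1 \<le> i \<and> i < n \<and> 1 \<le> j \<and> j < n \<and> \<bar>int i - int j\<bar> > 1"

definition VB_rels :: "nat \<Rightarrow> (vb_gen list \<times> vb_gen list) set" where
  "VB_rels n =
     {([Sg i, Sg j], [Sg j, Sg i]) | i j. far n i j} \<union>
     {([Zt i, Zt j], [Zt j, Zt i]) | i j. far n i j} \<union>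
     {([Sg i, Zt j], [Zt j, Sg i]) | i j. far n i j} \<union>
     {([Zt i, Zt i], []) | i. 1 \<le> i \<and> i < n} \<union>
     {([Sg i, Sg (i+1), Sg i], [Sg (i+1), Sg i, Sg (i+1)]) | i. 1 \<le> i \<and> i + 1 < n} \<union>
     {([Zt i, Zt (i+1), Zt i], [Zt (i+1), Zt i, Zt (i+1)]) | i. 1 \<le> i \<and> i + 1 < n} \<union>
     {([Zt i, Zt (i+1), Sg i], [Sg (i+1), Zt i, Zt (i+1)]) | i. 1 \<le> i \<and> i + 1 < n}"

definition VB_monoid :: "nat \<Rightarrow> vb_gen list set monoid" where
  "VB_monoid n = presented_monoid (VB_gens n) (VB_rels n)"

definition VB_monoid_gen :: "nat \<Rightarrow> vb_gen \<Rightarrow> vb_gen list set" where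
  "VB_monoid_gen n x = word_class (VB_gens n) (VB_rels n) [x]"

definition VB_group :: "nat \<Rightarrow> (vb_gen \<times> bool) list set monoid" where
  "VB_group n = presented_group (VB_gens n) (VB_rels n)"

definition VB_group_gen :: "nat \<Rightarrow> vb_gen \<Rightarrow> (vb_gen \<times> bool) list set" where
  "VB_group_gen n x =
     word_class (group_letters (VB_gens n)) (group_relations (VB_gens n) (VB_rels n)) [(x, True)]"

section \<open>Actions on tensor powers\<close>

fun obj_power :: "('o, 'm, 'x) symmetric_data_scheme \<Rightarrow> 'o \<Rightarrow> nat \<Rightarrow> 'o" where
  "obj_power C V 0 = Tunit C"
| "obj_power C V (Suc k) = V \<odot>\<^bsub>C\<^esub> obj_power C V k"

fun arr_power :: "('o, 'm, 'x) symmetric_data_scheme \<Rightarrow> 'm \<Rightarrow> nat \<Rightarrow> 'm" where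
  "arr_power C f 0 = Ident C (Tunit C)"
| "arr_power C f (Suc k) = f \<boxtimes>\<^bsub>C\<^esub> arr_power C f k"

definition End_monoid :: "('o, 'm, 'x) symmetric_data_scheme \<Rightarrow> 'o \<Rightarrow> 'm monoid" where
  "End_monoid C X = \<lparr>carrier = Hom C X X, mult = Comp C, one = Ident C X\<rparr>"

definition Aut_group :: "('o, 'm, 'x) symmetric_data_scheme \<Rightarrow> 'o \<Rightarrow> 'm monoid" where
  "Aut_group C X = units_of (End_monoid C X)"

text \<open>\<open>local_arr C V n \<phi> i\<close> is \<open>\<phi>\<^sub>i\<close>, acting on the \<open>i\<close>-th and \<open>(i+1)\<close>-st factors of the \<open>n\<close>-th
  tensor power of \<open>V\<close>; it is only used for \<open>1 \<le> i < n\<close>, where the subtractions do not truncate.\<close>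

definition local_arr ::
    "('o, 'm, 'x) symmetric_data_scheme \<Rightarrow> 'o \<Rightarrow> nat \<Rightarrow> 'm \<Rightarrow> nat \<Rightarrow> 'm" where
  "local_arr C V n \<phi> i =
     arr_power C (Ident C V) (i - 1) \<boxtimes>\<^bsub>C\<^esub> \<phi> \<boxtimes>\<^bsub>C\<^esub> arr_power C (Ident C V) (n - i - 1)"

text \<open>The library's \<^const>\<open>hom\<close> only asks for compatibility with products, so that preservation of
  the unit is demanded separately in the monoid case.\<close>

definition defines_VB_monoid_action ::
    "('o, 'm, 'x) symmetric_data_scheme \<Rightarrow> 'o \<Rightarrow> 'm \<Rightarrow> 'm \<Rightarrow> bool" where
  "defines_VB_monoid_action C V \<xi> \<theta> \<longleftrightarrow>
     \<xi> \<in> Hom C (V \<odot>\<^bsub>C\<^esub> V) (V \<odot>\<^bsub>C\<^esub> V) \<and> \<theta> \<in> Hom C (V \<odot>\<^bsub>C\<^esub> V) (V \<odot>\<^bsub>C\<^esub> V) \<and>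
     (\<forall>n. \<exists>h \<in> hom (VB_monoid n) (End_monoid C (obj_power C V n)).
        h \<one>\<^bsub>VB_monoid n\<^esub> = \<one>\<^bsub>End_monoid C (obj_power C V n)\<^esub> \<and>
        (\<forall>i. 1 \<le> i \<and> i < n \<longrightarrow>
           h (VB_monoid_gen n (Zt i)) = local_arr C V n \<xi> i \<and>
           h (VB_monoid_gen n (Sg i)) = local_arr C V n \<theta> i))"

definition defines_VB_group_action ::
    "('o, 'm, 'x) symmetric_data_scheme \<Rightarrow> 'o \<Rightarrow> 'm \<Rightarrow> 'm \<Rightarrow> bool" where
  "defines_VB_group_action C V \<xi> \<theta> \<longleftrightarrow>
     \<xi> \<in> Hom C (V \<odot>\<^bsub>C\<^esub> V) (V \<odot>\<^bsub>C\<^esub> V) \<and> \<theta> \<in> Hom C (V \<odot>\<^bsub>C\<^esub> V) (V \<odot>\<^bsub>C\<^esub> V) \<and>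
     (\<forall>n. \<exists>h \<in> hom (VB_group n) (Aut_group C (obj_power C V n)).
        \<forall>i. 1 \<le> i \<and> i < n \<longrightarrow>
           h (VB_group_gen n (Zt i)) = local_arr C V n \<xi> i \<and>
           h (VB_group_gen n (Sg i)) = local_arr C V n \<theta> i)"

definition sigma_assoc :: "('o, 'm, 'x) symmetric_data_scheme \<Rightarrow> 'm \<Rightarrow> 'm \<Rightarrow> 'm" where
  "sigma_assoc C mu nu = nu \<boxtimes>\<^bsub>C\<^esub> mu"

definition sigma_Leibniz ::
    "('o, 'm, 'x) preadditive_data_scheme \<Rightarrow> 'o \<Rightarrow> 'm \<Rightarrow> 'm \<Rightarrow> 'm" where
  "sigma_Leibniz C V br nu = Hadd C (Symm C V V) (nu \<boxtimes>\<^bsub>C\<^esub> br)"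

end

theory Submission
  imports Defs "HOL-Algebra.Ring"
begin

text \<open>Naturality of the symmetry with respect to the hexagon
  \<open>c\<^bsub>V\<otimes>V,V\<^esub> = c\<^sub>1 c\<^sub>2\<close> gives the mixed relation \<open>c\<^sub>1 c\<^sub>2 \<theta>\<^sub>1 = \<theta>\<^sub>2 c\<^sub>1 c\<^sub>2\<close>
  for every \<open>\<theta>\<close>, and for \<open>\<theta> = c\<close> the braid relation of \<open>c\<close>. Far commutation is bifunctoriality
  of the tensor product. So \<open>(c, \<theta>)\<close> defines a monoid action as soon as \<open>\<theta>\<close> satisfies the
  braid relation on the third tensor power, and a group action if \<open>\<theta>\<close> is moreover invertible.
  For \<open>\<nu> \<otimes> \<mu>\<close> both sides of the braid relation are \<open>\<nu> \<otimes> \<nu> \<otimes> \<mu>(\<mu> \<otimes> 1)\<close>. For \<open>c + t\<close> with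
  \<open>t = \<nu> \<otimes> [,]\<close>, the terms of degree at most one in \<open>t\<close> agree by the mixed relation, those of
  degree two agree by the Leibniz identity after the unit axioms annihilate \<open>t\<^sub>1 t\<^sub>2\<close> and
  \<open>t\<^sub>1 c\<^sub>2 t\<^sub>1\<close>; since \<open>t c t = 0\<close>, the inverse of \<open>c + t\<close> is \<open>c - c t c\<close>.\<close>

section \<open>Evaluating words in monoids and groups\<close>

text \<open>The right fold yields right-nested products ending in the unit; the relations between
  local arrows below are bracketed to match.\<close>

definition word_eval :: "('a, 'b) monoid_scheme \<Rightarrow> ('g \<Rightarrow> 'a) \<Rightarrow> 'g list \<Rightarrow> 'a" where
  "word_eval G f w = foldr (\<lambda>x. mult G (f x)) w (one G)"

lemma word_eval_simps [simp]:
  "word_eval G f [] = \<one>\<^bsub>G\<^esub>"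
  "word_eval G f (x # w) = f x \<otimes>\<^bsub>G\<^esub> word_eval G f w"
  by (simp_all add: word_eval_def)

text \<open>\<open>units_of\<close> changes only the carrier, so relations checked among
  endomorphisms carry over to automorphisms.\<close>

lemma word_eval_units_of: "word_eval (units_of G) f w = word_eval G f w"
  by (simp add: word_eval_def units_of_mult units_of_one)

context monoid
begin

lemma word_eval_closed:
  assumes "\<And>x. x \<in> X \<Longrightarrow> f x \<in> carrier G" "w \<in> lists X"
  shows "word_eval G f w \<in> carrier G"
  using assms(2) by (induction w) (auto simp: assms(1))

lemma word_eval_append:
  assumes "\<And>x. x \<in> X \<Longrightarrow> f x \<in> carrier G" "u \<in> lists X" "v \<in> lists X"
  shows "word_eval G f (u @ v) = word_eval G f u \<otimes> word_eval G f v"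
  using assms(2) by (induction u) (auto simp: assms word_eval_closed[of X] m_assoc)

lemma word_eval_cong:
  assumes f: "\<And>x. x \<in> X \<Longrightarrow> f x \<in> carrier G"
    and rel: "\<And>u v. (u, v) \<in> R \<Longrightarrow> word_eval G f u = word_eval G f v"
    and "word_cong X R u v"
  shows "word_eval G f u = word_eval G f v"
  using assms(3)
proof (induction rule: word_cong.induct)
  case (word_cong_rel u v a b)
  then show ?case using rel[of u v] by (simp add: word_eval_append[OF f])
qed auto

text \<open>Universal property of the presentation: evaluation of words is constant on congruence
  classes, so it descends to them.\<close>

lemma presented_monoid_hom:
  assumes f: "\<And>x. x \<in> X \<Longrightarrow> f x \<in> carrier G"
    and rel: "\<And>u v. (u, v) \<in> R \<Longrightarrow> word_eval G f u = word_eval G f v"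
  obtains h where "h \<in> hom (presented_monoid X R) G"
    and "h \<one>\<^bsub>presented_monoid X R\<^esub> = \<one>"
    and "\<And>x. x \<in> X \<Longrightarrow> h (word_class X R [x]) = f x"
proof
  \<comment> \<open>A class is evaluated at a chosen representative; the fact \<open>h\<close> below
    shows that the choice does not matter.\<close>
  define h where "h A = word_eval G f (SOME w. w \<in> A)" for A
  have h: "h (word_class X R u) = word_eval G f u" if "u \<in> lists X" for u
  proof -
    have "word_cong X R u (SOME w. w \<in> word_class X R u)"
      using someI[of "\<lambda>w. w \<in> word_class X R u" u] word_cong_refl[OF that]
      by (simp add: word_class_def)
    then show ?thesis using word_eval_cong[OF f rel] by (simp add: h_def)
  qed
  show "h \<in> hom (presented_monoid X R) G"
  proof (rule homI)
    fix A assume "A \<in> carrier (presented_monoid X R)"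
    then obtain u where "u \<in> lists X" "A = word_class X R u"
      by (auto simp: presented_monoid_def)
    then show "h A \<in> carrier G"
      using word_eval_closed[OF f] by (simp only: h)
  next
    fix A B assume "A \<in> carrier (presented_monoid X R)" "B \<in> carrier (presented_monoid X R)"
    then obtain u v where uv: "u \<in> lists X" "v \<in> lists X"
        "A = word_class X R u" "B = word_class X R v"
      by (auto simp: presented_monoid_def)
    then show "h (A \<otimes>\<^bsub>presented_monoid X R\<^esub> B) = h A \<otimes> h B"
      by (simp add: presented_monoid_mult h word_eval_append[OF f] del: in_lists_conv_set)
  qed
  show "h \<one>\<^bsub>presented_monoid X R\<^esub> = \<one>"
    by (simp add: presented_monoid_def h)
  show "h (word_class X R [x]) = f x" if "x \<in> X" for x
    using that by (simp add: h f)
qed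

end

text \<open>A presented group is a presented monoid on signed letters. Sending each negative letter
  to the inverse makes the added cancellation relations hold, so the monoid version applies.\<close>

lemma (in group) presented_group_hom:
  assumes f: "\<And>x. x \<in> X \<Longrightarrow> f x \<in> carrier G"
    and rel: "\<And>u v. (u, v) \<in> R \<Longrightarrow> word_eval G f u = word_eval G f v"
  obtains h where "h \<in> hom (presented_group X R) G"
    and "\<And>x. x \<in> X \<Longrightarrow>
      h (word_class (group_letters X) (group_relations X R) [(x, True)]) = f x"
proof -
  define g where "g = (\<lambda>(x, e). if e then f x else inv (f x))"
  have g: "g y \<in> carrier G" if "y \<in> group_letters X" for y
    using that f by (auto simp: g_def group_letters_def)
  have pos: "word_eval G g (positive_word w) = word_eval G f w" for w
    by (induction w) (simp_all add: positive_word_def g_def)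
  have "word_eval G g u = word_eval G g v" if "(u, v) \<in> group_relations X R" for u v
    using that unfolding group_relations_def
  proof (elim UnE)
    assume "(u, v) \<in> {(positive_word u, positive_word v) | u v. (u, v) \<in> R}"
    then show ?thesis using rel by (auto simp: pos)
  next
    assume "(u, v) \<in> {([(x, e), (x, \<not> e)], []) | x e. x \<in> X}"
    then show ?thesis using f by (auto simp: g_def)
  qed
  from presented_monoid_hom[of "group_letters X" g, OF g this]
  obtain h where h: "h \<in> hom (presented_group X R) G"
    "\<And>y. y \<in> group_letters X \<Longrightarrow> h (word_class (group_letters X) (group_relations X R) [y]) = g y"
    unfolding presented_group_def by metis
  have "h (word_class (group_letters X) (group_relations X R) [(x, True)]) = f x" if "x \<in> X" for x
    using h(2)[of "(x, True)"] that by (simp add: group_letters_def g_def)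
  with h(1) show ?thesis by (rule that)
qed

section \<open>Arrows in strict symmetric categories\<close>

context category
begin

text \<open>The locale axioms mention intermediate objects that a rewrite rule cannot guess. Phrased
  with \<open>Arr\<close>, \<open>Dom\<close> and \<open>Cod\<close>, they become conditional rules
  whose side conditions simplification can compute.\<close>

lemma Comp_Arr [simp]:
  assumes "f \<in> Arr C" "g \<in> Arr C" "Cod C f = Dom C g"
  shows "g \<cdot> f \<in> Arr C" "Dom C (g \<cdot> f) = Dom C f" "Cod C (g \<cdot> f) = Cod C g"
  using Comp_Hom[of f "Dom C f" "Cod C f" g "Cod C g"] assms by (simp_all add: Hom_def)

lemma Ident_Arr [simp]:
  assumes "X \<in> Obj C"
  shows "Ident C X \<in> Arr C" "Dom C (Ident C X) = X" "Cod C (Ident C X) = X"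
  using Ident_Hom[OF assms] by (simp_all add: Hom_def)

lemma Comp_Ident_Arr [simp]: "f \<in> Arr C \<Longrightarrow> Dom C f = X \<Longrightarrow> f \<cdot> Ident C X = f"
  using Comp_Ident[of f X "Cod C f"] by (simp add: Hom_def)

lemma Ident_Comp_Arr [simp]: "f \<in> Arr C \<Longrightarrow> Cod C f = X \<Longrightarrow> Ident C X \<cdot> f = f"
  using Ident_Comp[of f "Dom C f" X] by (simp add: Hom_def)

lemma Comp_assoc_Arr:
  "f \<in> Arr C \<Longrightarrow> g \<in> Arr C \<Longrightarrow> h \<in> Arr C \<Longrightarrow> Cod C f = Dom C g \<Longrightarrow> Cod C g = Dom C h
    \<Longrightarrow> (h \<cdot> g) \<cdot> f = h \<cdot> (g \<cdot> f)"
  using Comp_assoc[of f "Dom C f" "Cod C f" g "Cod C g" h "Cod C h"] by (simp add: Hom_def)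

end

context strict_monoidal_category
begin

text \<open>Strictness gives a normal form: tensor products nest to the right and adjacent
  identities merge. \<open>Tarr_Ident\<close> is switched off wherever identities must stay separate
  for interchange.\<close>

declare Tunit_Obj [simp] Tobj_Obj [simp] Tobj_assoc [simp] Tobj_unit_left [simp]
  Tobj_unit_right [simp] Tarr_unit_left [simp] Tarr_unit_right [simp] Tarr_Ident [simp]
  Dom_Obj [simp] Cod_Obj [simp] Tarr_assoc [simp]

lemma Tarr_Arr [simp]:
  assumes "f \<in> Arr C" "g \<in> Arr C"
  shows "f \<boxtimes> g \<in> Arr C" "Dom C (f \<boxtimes> g) = Dom C f \<odot> Dom C g"
    "Cod C (f \<boxtimes> g) = Cod C f \<odot> Cod C g"
  using Tarr_Hom[of f "Dom C f" "Cod C f" g "Dom C g" "Cod C g"] assms by (simp_all add: Hom_def)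

lemma interchange:
  assumes "f \<in> Arr C" "g \<in> Arr C" "f' \<in> Arr C" "g' \<in> Arr C"
    "Cod C f = Dom C g" "Cod C f' = Dom C g'"
  shows "(g \<boxtimes> g') \<cdot> (f \<boxtimes> f') = (g \<cdot> f) \<boxtimes> (g' \<cdot> f')"
  using Tarr_Comp[of f "Dom C f" "Cod C f" g "Cod C g" f' "Dom C f'" "Cod C f'" g' "Cod C g'"] assms
  by (simp add: Hom_def)

text \<open>By strictness \<open>f\<close> is the identity of the unit object tensored with
  \<open>f\<close>, so it slides past the state \<open>nu\<close>. This is the main computation rule
  for both algebras.\<close>

lemma state_Tarr_Comp:
  assumes "nu \<in> Hom C (Tunit C) V" "f \<in> Arr C" "g \<in> Arr C" "Cod C f = Dom C g"
  shows "(nu \<boxtimes> g) \<cdot> f = nu \<boxtimes> (g \<cdot> f)"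
proof -
  have "(nu \<boxtimes> g) \<cdot> (Ident C (Tunit C) \<boxtimes> f) = nu \<boxtimes> (g \<cdot> f)"
    using assms by (subst interchange) (auto simp: Hom_def)
  then show ?thesis using assms by simp
qed

lemma monoid_End_monoid: "X \<in> Obj C \<Longrightarrow> monoid (End_monoid C X)"
  by (rule monoidI) (auto simp: End_monoid_def Hom_def Comp_assoc_Arr)

lemma group_Aut_group: "X \<in> Obj C \<Longrightarrow> group (Aut_group C X)"
  unfolding Aut_group_def by (intro monoid.units_group monoid_End_monoid)

lemma obj_power_Obj [simp]: "V \<in> Obj C \<Longrightarrow> obj_power C V n \<in> Obj C"
  by (induction n) simp_all

lemma obj_power_add: "V \<in> Obj C \<Longrightarrow> obj_power C V (m + n) = obj_power C V m \<odot> obj_power C V n"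
  by (induction m) simp_all

lemma obj_power_Suc_right: "V \<in> Obj C \<Longrightarrow> obj_power C V (Suc n) = obj_power C V n \<odot> V"
  using obj_power_add[of V n 1] by simp

lemma arr_power_Ident: "V \<in> Obj C \<Longrightarrow> arr_power C (Ident C V) n = Ident C (obj_power C V n)"
  by (induction n) simp_all

end

section \<open>Local arrows on tensor powers\<close>

definition whisker :: "('o, 'm, 'x) symmetric_data_scheme \<Rightarrow> 'o \<Rightarrow> 'o \<Rightarrow> 'm \<Rightarrow> 'm" where
  "whisker C X Y f = Ident C X \<boxtimes>\<^bsub>C\<^esub> f \<boxtimes>\<^bsub>C\<^esub> Ident C Y"

context strict_monoidal_category
begin

lemma whisker_Arr [simp]:
  assumes "X \<in> Obj C" "Y \<in> Obj C" "f \<in> Arr C"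
  shows "whisker C X Y f \<in> Arr C" "Dom C (whisker C X Y f) = X \<odot> Dom C f \<odot> Y"
    "Cod C (whisker C X Y f) = X \<odot> Cod C f \<odot> Y"
  using assms by (simp_all add: whisker_def)

text \<open>Functoriality of whiskering transports identities from the second and third tensor
  powers to all higher ones.\<close>

lemma whisker_Comp:
  assumes "X \<in> Obj C" "Y \<in> Obj C" "f \<in> Arr C" "g \<in> Arr C" "Cod C f = Dom C g"
  shows "whisker C X Y g \<cdot> whisker C X Y f = whisker C X Y (g \<cdot> f)"
  using assms by (simp add: whisker_def interchange)

lemma whisker_Ident:
  "X \<in> Obj C \<Longrightarrow> Y \<in> Obj C \<Longrightarrow> Z \<in> Obj C \<Longrightarrow> whisker C X Y (Ident C Z) = Ident C (X \<odot> Z \<odot> Y)"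
  by (simp add: whisker_def)

lemma local_arr_whisker:
  assumes "V \<in> Obj C"
  shows "local_arr C V n f i = whisker C (obj_power C V (i - 1)) (obj_power C V (n - i - 1)) f"
  using assms by (simp add: local_arr_def whisker_def arr_power_Ident)

lemma obj_power_split_pair:
  assumes "V \<in> Obj C" "1 \<le> i" "i < n"
  shows "obj_power C V n = obj_power C V (i - 1) \<odot> (V \<odot> V) \<odot> obj_power C V (n - i - 1)"
proof -
  have "n = (i - 1) + Suc (Suc (n - i - 1))" using assms by linarith
  then have "obj_power C V n = obj_power C V ((i - 1) + Suc (Suc (n - i - 1)))" by (rule arg_cong)
  then show ?thesis using assms(1) by (simp only: obj_power_add obj_power.simps) simp
qed

lemma local_arr_Hom:
  assumes "V \<in> Obj C" "f \<in> Hom C (V \<odot> V) (V \<odot> V)" "1 \<le> i" "i < n"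
  shows "local_arr C V n f i \<in> Hom C (obj_power C V n) (obj_power C V n)"
  using assms obj_power_split_pair[OF assms(1,3,4)] by (auto simp: local_arr_whisker Hom_def)

text \<open>Together with \<open>local_arr_right\<close>, this presents the arrows at
  \<open>i\<close> and \<open>i + 1\<close> as whiskerings by the same outer objects, so that
  relations between them reduce to the third tensor power.\<close>

lemma local_arr_left:
  assumes "V \<in> Obj C" "f \<in> Arr C" "1 \<le> i" "i + 1 < n"
  shows "local_arr C V n f i =
    whisker C (obj_power C V (i - 1)) (obj_power C V (n - i - 2)) (f \<boxtimes> Ident C V)"
proof -
  have "n - i - 1 = Suc (n - i - 2)" using assms by linarith
  then have "Ident C (obj_power C V (n - i - 1)) = Ident C V \<boxtimes> Ident C (obj_power C V (n - i - 2))"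
    using assms by (simp only: obj_power.simps) simp
  then show ?thesis using assms by (simp add: local_arr_whisker whisker_def del: Tarr_Ident)
qed

lemma local_arr_right:
  assumes "V \<in> Obj C" "f \<in> Arr C" "1 \<le> i" "i + 1 < n"
  shows "local_arr C V n f (i + 1) =
    whisker C (obj_power C V (i - 1)) (obj_power C V (n - i - 2)) (Ident C V \<boxtimes> f)"
proof -
  have "i + 1 - 1 = Suc (i - 1)" "n - (i + 1) - 1 = n - i - 2" using assms by linarith+
  then have eq: "local_arr C V n f (i + 1) =
      Ident C (obj_power C V (Suc (i - 1))) \<boxtimes> f \<boxtimes> Ident C (obj_power C V (n - i - 2))"
    using assms by (simp only: local_arr_whisker whisker_def)
  \<comment> \<open>The additional factor has to stand next to \<open>f\<close>, so it is split off
    on the right although \<open>obj_power\<close> grows on the left.\<close>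
  have "Ident C (obj_power C V (Suc (i - 1))) = Ident C (obj_power C V (i - 1)) \<boxtimes> Ident C V"
    using assms(1) by (simp only: obj_power_Suc_right Tarr_Ident obj_power_Obj)
  then show ?thesis unfolding eq using assms by (simp add: whisker_def del: Tarr_Ident obj_power.simps)
qed

text \<open>Over a common decomposition into five blocks the two arrows act on different blocks; by
  interchange both composites are the same tensor product.\<close>

lemma local_arr_far_commute_less:
  assumes V: "V \<in> Obj C" and f: "f \<in> Hom C (V \<odot> V) (V \<odot> V)" and g: "g \<in> Hom C (V \<odot> V) (V \<odot> V)"
    and "1 \<le> i" "i + 1 < j" "j < n"
  shows "local_arr C V n f i \<cdot> local_arr C V n g j = local_arr C V n g j \<cdot> local_arr C V n f i"
proof -
  let ?I = "\<lambda>k. Ident C (obj_power C V k)" and ?II = "Ident C (V \<odot> V)"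
  \<comment> \<open>The number of factors strictly between the pairs \<open>i, i + 1\<close> and
    \<open>j, j + 1\<close>, possibly 0.\<close>
  define m where "m = j - i - 2"
  have n: "n - i - 1 = m + Suc (Suc (n - j - 1))" and j: "j - 1 = (i - 1) + Suc (Suc m)"
    using assms by (simp_all add: m_def)
  have "?I (n - i - 1) = ?I m \<boxtimes> ?II \<boxtimes> ?I (n - j - 1)"
    unfolding n using V by (simp only: obj_power_add obj_power.simps) simp
  then have fi: "local_arr C V n f i = ?I (i - 1) \<boxtimes> f \<boxtimes> ?I m \<boxtimes> ?II \<boxtimes> ?I (n - j - 1)"
    using V by (simp add: local_arr_whisker whisker_def)
  have "?I (j - 1) = ?I (i - 1) \<boxtimes> ?II \<boxtimes> ?I m"
    unfolding j using V by (simp only: obj_power_add obj_power.simps) simp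
  then have gj: "local_arr C V n g j = ?I (i - 1) \<boxtimes> ?II \<boxtimes> ?I m \<boxtimes> g \<boxtimes> ?I (n - j - 1)"
    using V g by (simp add: local_arr_whisker whisker_def Hom_def del: Tarr_Ident)
  show ?thesis unfolding fi gj
    using V f g by (simp add: interchange Hom_def del: Tarr_Ident)
qed

lemma local_arr_far_commute:
  assumes "V \<in> Obj C" "f \<in> Hom C (V \<odot> V) (V \<odot> V)" "g \<in> Hom C (V \<odot> V) (V \<odot> V)" "far n i j"
  shows "local_arr C V n f i \<cdot> local_arr C V n g j = local_arr C V n g j \<cdot> local_arr C V n f i"
proof (cases "i < j")
  case True
  then show ?thesis using assms by (intro local_arr_far_commute_less) (auto simp: far_def)
next
  case False
  then show ?thesis using assms
    by (intro local_arr_far_commute_less[symmetric]) (auto simp: far_def)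
qed

text \<open>Six independent arrows let one statement cover the braid relations of \<open>th\<close>
  and of the symmetry as well as the mixed relation.\<close>

lemma local_arr_relation:
  assumes V: "V \<in> Obj C" and i: "1 \<le> i" "i + 1 < n"
    and "f \<in> Hom C (V \<odot> V) (V \<odot> V)" "g \<in> Hom C (V \<odot> V) (V \<odot> V)" "h \<in> Hom C (V \<odot> V) (V \<odot> V)"
      "f' \<in> Hom C (V \<odot> V) (V \<odot> V)" "g' \<in> Hom C (V \<odot> V) (V \<odot> V)" "h' \<in> Hom C (V \<odot> V) (V \<odot> V)"
    and eq: "(f \<boxtimes> Ident C V) \<cdot> ((Ident C V \<boxtimes> g) \<cdot> (h \<boxtimes> Ident C V)) =
      (Ident C V \<boxtimes> f') \<cdot> ((g' \<boxtimes> Ident C V) \<cdot> (Ident C V \<boxtimes> h'))"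
  shows "local_arr C V n f i \<cdot> (local_arr C V n g (i + 1) \<cdot> local_arr C V n h i) =
    local_arr C V n f' (i + 1) \<cdot> (local_arr C V n g' i \<cdot> local_arr C V n h' (i + 1))"
proof -
  have [simp]: "k \<in> Arr C" "Dom C k = V \<odot> V" "Cod C k = V \<odot> V"
    if "k = f \<or> k = g \<or> k = h \<or> k = f' \<or> k = g' \<or> k = h'" for k
    using that assms by (auto simp: Hom_def)
  show ?thesis
    using V eq by (simp add: local_arr_left[OF V _ i] local_arr_right[OF V _ i, simplified] whisker_Comp)
qed

end

section \<open>Virtual braid actions\<close>

context symmetric_category
begin

lemma Symm_Arr [simp]:
  assumes "X \<in> Obj C" "Y \<in> Obj C"
  shows "Symm C X Y \<in> Arr C" "Dom C (Symm C X Y) = X \<odot> Y" "Cod C (Symm C X Y) = Y \<odot> X"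
  using Symm_Hom[OF assms] by (simp_all add: Hom_def)

lemma Symm_natural_Arr:
  "f \<in> Arr C \<Longrightarrow> g \<in> Arr C \<Longrightarrow>
    Symm C (Cod C f) (Cod C g) \<cdot> (f \<boxtimes> g) = (g \<boxtimes> f) \<cdot> Symm C (Dom C f) (Dom C g)"
  by (rule Symm_natural) (simp_all add: Hom_def)

text \<open>The hexagon for \<open>I \<otimes> I = I\<close> shows that \<open>c\<^bsub>I,X\<^esub>\<close> is idempotent; being invertible, it is the identity.\<close>

lemma Symm_unit_left:
  assumes X: "X \<in> Obj C"
  shows "Symm C (Tunit C) X = Ident C X"
proof -
  let ?c = "Symm C (Tunit C) X" and ?d = "Symm C X (Tunit C)"
  have idem: "?c \<cdot> ?c = ?c"
    using Symm_hexagon_left[of "Tunit C" "Tunit C" X] X by simp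
  have inv: "?d \<cdot> ?c = Ident C X"
    using Symm_inverse[of "Tunit C" X] X by simp
  have "?c = (?d \<cdot> ?c) \<cdot> ?c"
    unfolding inv using X by simp
  also have "\<dots> = ?d \<cdot> (?c \<cdot> ?c)"
    using X by (simp add: Comp_assoc_Arr)
  finally show ?thesis by (simp add: idem inv)
qed

lemma Symm_unit_right: "X \<in> Obj C \<Longrightarrow> Symm C X (Tunit C) = Ident C X"
  using Symm_inverse[of "Tunit C" X] by (simp add: Symm_unit_left)

lemma Symm_mixed_relation:
  assumes V: "V \<in> Obj C" and f: "f \<in> Hom C (V \<odot> V) (V \<odot> V)"
  shows "(Symm C V V \<boxtimes> Ident C V) \<cdot> ((Ident C V \<boxtimes> Symm C V V) \<cdot> (f \<boxtimes> Ident C V)) =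
    (Ident C V \<boxtimes> f) \<cdot> ((Symm C V V \<boxtimes> Ident C V) \<cdot> (Ident C V \<boxtimes> Symm C V V))"
proof -
  have "(Symm C V V \<boxtimes> Ident C V) \<cdot> ((Ident C V \<boxtimes> Symm C V V) \<cdot> (f \<boxtimes> Ident C V)) =
      Symm C (V \<odot> V) V \<cdot> (f \<boxtimes> Ident C V)"
    using V f by (simp add: Symm_hexagon_left Comp_assoc_Arr Hom_def)
  also have "\<dots> = (Ident C V \<boxtimes> f) \<cdot> Symm C (V \<odot> V) V"
    using V f Symm_natural_Arr[of f "Ident C V"] by (simp add: Hom_def)
  finally show ?thesis using V by (simp add: Symm_hexagon_left)
qed

lemma VB_rels_local_arr:
  assumes V: "V \<in> Obj C" and th: "th \<in> Hom C (V \<odot> V) (V \<odot> V)"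
    and YBE: "(th \<boxtimes> Ident C V) \<cdot> ((Ident C V \<boxtimes> th) \<cdot> (th \<boxtimes> Ident C V)) =
      (Ident C V \<boxtimes> th) \<cdot> ((th \<boxtimes> Ident C V) \<cdot> (Ident C V \<boxtimes> th))"
    and "(u, v) \<in> VB_rels n"
  defines "f \<equiv> case_vb_gen (local_arr C V n th) (local_arr C V n (Symm C V V))"
  shows "word_eval (End_monoid C (obj_power C V n)) f u =
    word_eval (End_monoid C (obj_power C V n)) f v"
proof -
  have c: "Symm C V V \<in> Hom C (V \<odot> V) (V \<odot> V)" using V by (simp add: Symm_Hom)
  \<comment> \<open>Removes the trailing identity that \<open>word_eval\<close> leaves.\<close>
  have unit [simp]: "local_arr C V n g i \<cdot> Ident C (obj_power C V n) = local_arr C V n g i"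
    if "g \<in> {Symm C V V, th}" "1 \<le> i" "i < n" for g i
    using that local_arr_Hom[OF V c that(2,3)] local_arr_Hom[OF V th that(2,3)]
    by (auto simp: Hom_def)
  have invol: "local_arr C V n (Symm C V V) i \<cdot> local_arr C V n (Symm C V V) i =
      Ident C (obj_power C V n)" if "1 \<le> i" "i < n" for i
    using V Symm_inverse[OF V V] obj_power_split_pair[OF V that]
    by (simp add: local_arr_whisker whisker_Comp whisker_Ident del: Tobj_assoc)
  \<comment> \<open>The facts match the families in \<open>VB_rels\<close>: three far commutations,
    the involution, two braid relations and the mixed one. The braid relation of the symmetry is the
    mixed relation with the symmetry as \<open>f\<close>.\<close>
  show ?thesis
    using assms(4)
      local_arr_far_commute[OF V th th] local_arr_far_commute[OF V c c]
      local_arr_far_commute[OF V th c] invol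
      local_arr_relation[OF V _ _ th th th th th th YBE]
      local_arr_relation[OF V _ _ c c c c c c Symm_mixed_relation[OF V c]]
      local_arr_relation[OF V _ _ c c th th c c Symm_mixed_relation[OF V th]]
    unfolding VB_rels_def by (auto simp: f_def End_monoid_def far_def)
qed

lemma local_arr_End:
  assumes "V \<in> Obj C" "th \<in> Hom C (V \<odot> V) (V \<odot> V)" "x \<in> VB_gens n"
  shows "case_vb_gen (local_arr C V n th) (local_arr C V n (Symm C V V)) x
    \<in> carrier (End_monoid C (obj_power C V n))"
  using assms by (auto simp: VB_gens_def End_monoid_def intro!: local_arr_Hom Symm_Hom)

lemma defines_VB_monoid_action_YBE:
  assumes V: "V \<in> Obj C" and th: "th \<in> Hom C (V \<odot> V) (V \<odot> V)"
    and YBE: "(th \<boxtimes> Ident C V) \<cdot> ((Ident C V \<boxtimes> th) \<cdot> (th \<boxtimes> Ident C V)) =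
      (Ident C V \<boxtimes> th) \<cdot> ((th \<boxtimes> Ident C V) \<cdot> (Ident C V \<boxtimes> th))"
  shows "defines_VB_monoid_action C V (Symm C V V) th"
  unfolding defines_VB_monoid_action_def
proof (intro conjI allI)
  show "Symm C V V \<in> Hom C (V \<odot> V) (V \<odot> V)" using V by (simp add: Symm_Hom)
  show "th \<in> Hom C (V \<odot> V) (V \<odot> V)" by fact
  fix n
  let ?f = "case_vb_gen (local_arr C V n th) (local_arr C V n (Symm C V V))"
  obtain h where "h \<in> hom (VB_monoid n) (End_monoid C (obj_power C V n))"
    "h \<one>\<^bsub>VB_monoid n\<^esub> = \<one>\<^bsub>End_monoid C (obj_power C V n)\<^esub>"
    "\<And>x. x \<in> VB_gens n \<Longrightarrow> h (VB_monoid_gen n x) = ?f x"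
    using monoid.presented_monoid_hom[OF monoid_End_monoid[OF obj_power_Obj[OF V]]
        local_arr_End[OF V th] VB_rels_local_arr[OF V th YBE]]
    unfolding VB_monoid_def VB_monoid_gen_def by metis
  then show "\<exists>h\<in>hom (VB_monoid n) (End_monoid C (obj_power C V n)).
      h \<one>\<^bsub>VB_monoid n\<^esub> = \<one>\<^bsub>End_monoid C (obj_power C V n)\<^esub> \<and>
      (\<forall>i. 1 \<le> i \<and> i < n \<longrightarrow>
        h (VB_monoid_gen n (Zt i)) = local_arr C V n (Symm C V V) i \<and>
        h (VB_monoid_gen n (Sg i)) = local_arr C V n th i)"
    by (intro bexI[of _ h]) (auto simp: VB_gens_def)
qed

text \<open>Whiskering an inverse of \<open>f\<close> inverts the whiskered arrow.\<close>

lemma local_arr_Units: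
  assumes V: "V \<in> Obj C" and i: "1 \<le> i" "i < n"
    and f: "f \<in> Units (End_monoid C (V \<odot> V))"
  shows "local_arr C V n f i \<in> Units (End_monoid C (obj_power C V n))"
proof -
  from f obtain g where fg: "f \<in> Hom C (V \<odot> V) (V \<odot> V)" "g \<in> Hom C (V \<odot> V) (V \<odot> V)"
    "g \<cdot> f = Ident C (V \<odot> V)" "f \<cdot> g = Ident C (V \<odot> V)"
    by (auto simp: Units_def End_monoid_def)
  have "local_arr C V n g i \<cdot> local_arr C V n f i = Ident C (obj_power C V n)"
    "local_arr C V n f i \<cdot> local_arr C V n g i = Ident C (obj_power C V n)"
    using V fg obj_power_split_pair[OF V i]
    by (simp_all add: local_arr_whisker whisker_Comp whisker_Ident Hom_def del: Tobj_assoc)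
  then show ?thesis
    using local_arr_Hom[OF V fg(1) i] local_arr_Hom[OF V fg(2) i]
    by (auto simp: Units_def End_monoid_def)
qed

lemma defines_VB_group_action_YBE:
  assumes V: "V \<in> Obj C" and th: "th \<in> Units (End_monoid C (V \<odot> V))"
    and YBE: "(th \<boxtimes> Ident C V) \<cdot> ((Ident C V \<boxtimes> th) \<cdot> (th \<boxtimes> Ident C V)) =
      (Ident C V \<boxtimes> th) \<cdot> ((th \<boxtimes> Ident C V) \<cdot> (Ident C V \<boxtimes> th))"
  shows "defines_VB_group_action C V (Symm C V V) th"
  unfolding defines_VB_group_action_def
proof (intro conjI allI)
  show c: "Symm C V V \<in> Hom C (V \<odot> V) (V \<odot> V)" using V by (simp add: Symm_Hom)
  show th_Hom: "th \<in> Hom C (V \<odot> V) (V \<odot> V)" using th by (simp add: Units_def End_monoid_def)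
  have c_Units: "Symm C V V \<in> Units (End_monoid C (V \<odot> V))"
    using c Symm_inverse[OF V V] by (auto simp: Units_def End_monoid_def)
  fix n
  let ?f = "case_vb_gen (local_arr C V n th) (local_arr C V n (Symm C V V))"
  have f: "?f x \<in> carrier (Aut_group C (obj_power C V n))" if "x \<in> VB_gens n" for x
    using that local_arr_Units[OF V _ _ th] local_arr_Units[OF V _ _ c_Units]
    by (auto simp: VB_gens_def Aut_group_def units_of_carrier)
  have rel: "word_eval (Aut_group C (obj_power C V n)) ?f u =
      word_eval (Aut_group C (obj_power C V n)) ?f v" if "(u, v) \<in> VB_rels n" for u v
    unfolding Aut_group_def word_eval_units_of by (rule VB_rels_local_arr[OF V th_Hom YBE that])
  obtain h where "h \<in> hom (VB_group n) (Aut_group C (obj_power C V n))"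
    "\<And>x. x \<in> VB_gens n \<Longrightarrow> h (VB_group_gen n x) = ?f x"
    using group.presented_group_hom[OF group_Aut_group[OF obj_power_Obj[OF V]] f rel]
    unfolding VB_group_def VB_group_gen_def by metis
  then show "\<exists>h\<in>hom (VB_group n) (Aut_group C (obj_power C V n)).
      \<forall>i. 1 \<le> i \<and> i < n \<longrightarrow>
        h (VB_group_gen n (Zt i)) = local_arr C V n (Symm C V V) i \<and>
        h (VB_group_gen n (Sg i)) = local_arr C V n th i"
    by (intro bexI[of _ h]) (auto simp: VB_gens_def)
qed

section \<open>The braiding of a unital associative algebra\<close>

lemma unital_associative_YBE:
  assumes "unital_associative_algebra C V mu nu"
  defines "s \<equiv> sigma_assoc C mu nu"
  shows "(s \<boxtimes> Ident C V) \<cdot> ((Ident C V \<boxtimes> s) \<cdot> (s \<boxtimes> Ident C V)) =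
    (Ident C V \<boxtimes> s) \<cdot> ((s \<boxtimes> Ident C V) \<cdot> (Ident C V \<boxtimes> s))"
proof -
  let ?I = "Ident C V"
  have V: "V \<in> Obj C" and nu: "nu \<in> Hom C (Tunit C) V"
    and assoc: "mu \<cdot> (?I \<boxtimes> mu) = mu \<cdot> (mu \<boxtimes> ?I)"
    and unit: "mu \<cdot> (?I \<boxtimes> nu) = ?I"
    using assms by (simp_all add: unital_associative_algebra_def)
  have [simp]: "mu \<in> Arr C" "Dom C mu = V \<odot> V" "Cod C mu = V"
    "nu \<in> Arr C" "Dom C nu = Tunit C" "Cod C nu = V"
    using assms by (auto simp: unital_associative_algebra_def Hom_def)
  note V [simp]
  have nn: "mu \<cdot> (nu \<boxtimes> nu) = nu"
  proof -
    \<comment> \<open>Inserting the right-hand unit last exposes the right unit law.\<close>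
    have "nu \<boxtimes> nu = (?I \<boxtimes> nu) \<cdot> (nu \<boxtimes> Ident C (Tunit C))"
      by (subst interchange) simp_all
    then have "mu \<cdot> (nu \<boxtimes> nu) = (mu \<cdot> (?I \<boxtimes> nu)) \<cdot> nu"
      by (simp add: Comp_assoc_Arr)
    then show ?thesis by (simp add: unit)
  qed
  \<comment> \<open>A leading unit passes the second-position braiding untouched, and a new unit
    appears behind it.\<close>
  have s2: "(?I \<boxtimes> nu \<boxtimes> mu) \<cdot> (nu \<boxtimes> f) = nu \<boxtimes> nu \<boxtimes> (mu \<cdot> f)"
    if "f \<in> Arr C" "Cod C f = V \<odot> V" for f
    using that by (subst interchange) (simp_all add: state_Tarr_Comp[OF nu])
  have "(nu \<boxtimes> mu \<boxtimes> ?I) \<cdot> ((?I \<boxtimes> nu \<boxtimes> mu) \<cdot> (nu \<boxtimes> mu \<boxtimes> ?I)) = nu \<boxtimes> nu \<boxtimes> (mu \<cdot> (mu \<boxtimes> ?I))"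
  proof -
    \<comment> \<open>Here \<open>mu\<close> is fed two units and returns one.\<close>
    have "(mu \<boxtimes> ?I) \<cdot> ((nu \<boxtimes> nu) \<boxtimes> (mu \<cdot> (mu \<boxtimes> ?I))) = nu \<boxtimes> (mu \<cdot> (mu \<boxtimes> ?I))"
      by (subst interchange) (simp_all add: nn)
    then show ?thesis by (simp add: s2 state_Tarr_Comp[OF nu])
  qed
  moreover have "(?I \<boxtimes> nu \<boxtimes> mu) \<cdot> ((nu \<boxtimes> mu \<boxtimes> ?I) \<cdot> (?I \<boxtimes> nu \<boxtimes> mu)) =
      nu \<boxtimes> nu \<boxtimes> (mu \<cdot> (mu \<boxtimes> ?I))"
  proof -
    \<comment> \<open>Here \<open>mu\<close> absorbs the new unit by the right unit law;
      associativity then gives the same form as on the other side.\<close>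
    have "(mu \<boxtimes> ?I) \<cdot> ((?I \<boxtimes> nu) \<boxtimes> mu) = ?I \<boxtimes> mu"
      by (subst interchange) (simp_all add: unit)
    then show ?thesis by (simp add: s2 state_Tarr_Comp[OF nu] assoc)
  qed
  ultimately show ?thesis by (simp add: s_def sigma_assoc_def)
qed

end

section \<open>Endomorphism rings\<close>

text \<open>Meant for the endomorphism ring of the third tensor power, with \<open>c1\<close>,
  \<open>c2\<close> and \<open>t1\<close>, \<open>t2\<close> the two placements of the symmetry and
  of \<nu> \<otimes> [,].\<close>

lemma (in ring) sum_braid_relation:
  assumes [simp]: "c1 \<in> carrier R" "c2 \<in> carrier R" "t1 \<in> carrier R" "t2 \<in> carrier R"
    and c1: "c1 \<otimes> c1 = \<one>" and c2: "c2 \<otimes> c2 = \<one>"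
    and cc: "c1 \<otimes> (c2 \<otimes> c1) = c2 \<otimes> (c1 \<otimes> c2)"
    and mixed: "c1 \<otimes> (c2 \<otimes> t1) = t2 \<otimes> (c1 \<otimes> c2)"
    and tt: "t1 \<otimes> t2 = \<zero>" and tct: "t1 \<otimes> (c2 \<otimes> t1) = \<zero>"
    and ctt: "c1 \<otimes> (t2 \<otimes> t1) = t2 \<otimes> (c1 \<otimes> t2) \<oplus> t2 \<otimes> (t1 \<otimes> c2)"
  shows "(c1 \<oplus> t1) \<otimes> ((c2 \<oplus> t2) \<otimes> (c1 \<oplus> t1)) = (c2 \<oplus> t2) \<otimes> ((c1 \<oplus> t1) \<otimes> (c2 \<oplus> t2))"
proof -
  have cancel: "c1 \<otimes> (c1 \<otimes> x) = x" "c2 \<otimes> (c2 \<otimes> x) = x" if "x \<in> carrier R" for x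
    using that by (simp_all add: c1 c2 m_assoc[symmetric])
  \<comment> \<open>Solving \<open>mixed\<close> for \<open>t1\<close> makes it a conjugate of
    \<open>t2\<close>; the other two degree-one relations follow.\<close>
  have t1: "t1 = c2 \<otimes> (c1 \<otimes> (t2 \<otimes> (c1 \<otimes> c2)))"
    using cancel(1)[of "c2 \<otimes> t1"] cancel(2)[of t1] mixed by simp
  have ctc: "c1 \<otimes> (t2 \<otimes> c1) = c2 \<otimes> (t1 \<otimes> c2)"
    by (subst t1) (simp add: cancel m_assoc c2)
  have tcc: "t1 \<otimes> (c2 \<otimes> c1) = c2 \<otimes> (c1 \<otimes> t2)"
    by (subst t1) (simp add: cancel m_assoc c1)
  have t1t2: "t1 \<otimes> (t2 \<otimes> x) = \<zero>" if "x \<in> carrier R" for x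
    using that by (simp add: tt m_assoc[symmetric])
  \<comment> \<open>Three of the eight products on the left vanish, and two of those on the right;
    \<open>ctt\<close> matches one quadratic term with two.\<close>
  have "(c1 \<oplus> t1) \<otimes> ((c2 \<oplus> t2) \<otimes> (c1 \<oplus> t1)) =
      c1 \<otimes> (c2 \<otimes> c1) \<oplus> c1 \<otimes> (c2 \<otimes> t1) \<oplus> c1 \<otimes> (t2 \<otimes> c1) \<oplus> t1 \<otimes> (c2 \<otimes> c1) \<oplus> c1 \<otimes> (t2 \<otimes> t1)"
    by (simp add: l_distr r_distr a_ac tct t1t2)
  also have "\<dots> = c2 \<otimes> (c1 \<otimes> c2) \<oplus> t2 \<otimes> (c1 \<otimes> c2) \<oplus> c2 \<otimes> (t1 \<otimes> c2) \<oplus> c2 \<otimes> (c1 \<otimes> t2) \<oplus>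
      (t2 \<otimes> (c1 \<otimes> t2) \<oplus> t2 \<otimes> (t1 \<otimes> c2))"
    by (simp only: cc mixed ctc tcc ctt)
  also have "\<dots> = (c2 \<oplus> t2) \<otimes> ((c1 \<oplus> t1) \<otimes> (c2 \<oplus> t2))"
    by (simp add: l_distr r_distr a_ac tt)
  finally show ?thesis .
qed

text \<open>In \<open>c + t = c (1 + c t)\<close> the element \<open>c t\<close> has square zero, so
  the geometric series stops and the inverse is \<open>(1 - c t) c\<close>.\<close>

lemma (in ring) involution_plus_Units:
  assumes [simp]: "c \<in> carrier R" "t \<in> carrier R" and cc: "c \<otimes> c = \<one>" and tct: "t \<otimes> (c \<otimes> t) = \<zero>"
  shows "c \<oplus> t \<in> Units R"
proof -
  let ?d = "c \<ominus> c \<otimes> (t \<otimes> c)"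
  have cancel: "c \<otimes> (c \<otimes> x) = x" if "x \<in> carrier R" for x
    using that by (simp add: cc m_assoc[symmetric])
  have tct': "t \<otimes> (c \<otimes> (t \<otimes> c)) = \<zero>"
    using arg_cong[OF tct, of "\<lambda>x. x \<otimes> c"] by (simp add: m_assoc)
  have "(c \<oplus> t) \<otimes> ?d = \<one>" "?d \<otimes> (c \<oplus> t) = \<one>"
    by (simp_all add: minus_eq l_distr r_distr r_minus l_minus m_assoc cancel cc tct tct'
        a_ac r_neg l_neg r_neg1 r_neg2)
  then show ?thesis unfolding Units_def by auto
qed

definition End_ring :: "('o, 'm, 'x) preadditive_data_scheme \<Rightarrow> 'o \<Rightarrow> 'm ring" where
  "End_ring C X = \<lparr>carrier = Hom C X X, mult = Comp C, one = Ident C X,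
     zero = Hzero C X X, add = Hadd C\<rparr>"

section \<open>Zero morphisms, differences and endomorphism rings\<close>

context symmetric_preadditive_category
begin

lemma Hom_Obj: "f \<in> Hom C X Y \<Longrightarrow> X \<in> Obj C \<and> Y \<in> Obj C"
  by (auto simp: Hom_def)

lemma Hzero_Hom: "X \<in> Obj C \<Longrightarrow> Y \<in> Obj C \<Longrightarrow> Hzero C X Y \<in> Hom C X Y"
  using monoid.one_closed[OF group.is_monoid[OF comm_group.axioms(2)[OF Hom_comm_group[of X Y]]]]
  by (simp add: Hom_group_def)

lemma Hzero_Arr [simp]:
  assumes "X \<in> Obj C" "Y \<in> Obj C"
  shows "Hzero C X Y \<in> Arr C" "Dom C (Hzero C X Y) = X" "Cod C (Hzero C X Y) = Y"
  using Hzero_Hom[OF assms] by (simp_all add: Hom_def)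

lemma Hadd_Hzero:
  assumes "X \<in> Obj C" "Y \<in> Obj C"
  shows "Hadd C (Hzero C X Y) (Hzero C X Y) = Hzero C X Y"
proof -
  interpret G: comm_group "Hom_group C X Y" using assms by (rule Hom_comm_group)
  show ?thesis using G.l_one[of "Hzero C X Y"] assms Hzero_Hom by (simp add: Hom_group_def)
qed

text \<open>Only the neutral element of a group is idempotent. Bilinearity makes composites and
  tensor products with zero idempotent, hence zero.\<close>

lemma Hadd_idem_Hzero:
  assumes "f \<in> Hom C X Y" "Hadd C f f = f"
  shows "f = Hzero C X Y"
proof -
  interpret G: comm_group "Hom_group C X Y" using assms Hom_Obj by (blast intro: Hom_comm_group)
  show ?thesis using G.r_cancel_one[of f f] assms by (simp add: Hom_group_def)
qed

lemma Comp_Hzero_left: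
  assumes "f \<in> Hom C X Y" "Z \<in> Obj C"
  shows "Hzero C Y Z \<cdot> f = Hzero C X Z"
proof (rule Hadd_idem_Hzero)
  have z: "Hzero C Y Z \<in> Hom C Y Z" using assms Hom_Obj Hzero_Hom by blast
  show "Hzero C Y Z \<cdot> f \<in> Hom C X Z" using Comp_Hom[OF assms(1) z] .
  show "Hadd C (Hzero C Y Z \<cdot> f) (Hzero C Y Z \<cdot> f) = Hzero C Y Z \<cdot> f"
    using Comp_Hadd_left[OF assms(1) z z] Hadd_Hzero[of Y Z] assms Hom_Obj by metis
qed

lemma Tarr_Hzero_right:
  assumes "f \<in> Hom C X X'" "Y \<in> Obj C" "Y' \<in> Obj C"
  shows "f \<boxtimes> Hzero C Y Y' = Hzero C (X \<odot> Y) (X' \<odot> Y')"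
proof (rule Hadd_idem_Hzero)
  have z: "Hzero C Y Y' \<in> Hom C Y Y'" using assms Hzero_Hom by blast
  show "f \<boxtimes> Hzero C Y Y' \<in> Hom C (X \<odot> Y) (X' \<odot> Y')" using Tarr_Hom[OF assms(1) z] .
  show "Hadd C (f \<boxtimes> Hzero C Y Y') (f \<boxtimes> Hzero C Y Y') = f \<boxtimes> Hzero C Y Y'"
    using Tarr_Hadd_right[OF assms(1) z z] Hadd_Hzero[of Y Y'] assms by metis
qed

lemma Tarr_Hzero_left:
  assumes "f \<in> Hom C X X'" "Y \<in> Obj C" "Y' \<in> Obj C"
  shows "Hzero C Y Y' \<boxtimes> f = Hzero C (Y \<odot> X) (Y' \<odot> X')"
proof (rule Hadd_idem_Hzero)
  have z: "Hzero C Y Y' \<in> Hom C Y Y'" using assms Hzero_Hom by blast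
  show "Hzero C Y Y' \<boxtimes> f \<in> Hom C (Y \<odot> X) (Y' \<odot> X')" using Tarr_Hom[OF z assms(1)] .
  show "Hadd C (Hzero C Y Y' \<boxtimes> f) (Hzero C Y Y' \<boxtimes> f) = Hzero C Y Y' \<boxtimes> f"
    using Tarr_Hadd_left[OF z z assms(1)] Hadd_Hzero[of Y Y'] assms by metis
qed

lemma Hdiff_Hadd:
  assumes "f \<in> Hom C X Y" "g \<in> Hom C X Y"
  shows "Hadd C (Hdiff C f g) g = f"
proof -
  interpret G: comm_group "Hom_group C X Y" using assms Hom_Obj by (blast intro: Hom_comm_group)
  \<comment> \<open>\<open>Hdiff\<close> inverts in the group determined by \<open>Dom\<close> and
    \<open>Cod\<close> of \<open>g\<close>; here this is the expected one.\<close>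
  have "Dom C g = X" "Cod C g = Y" using assms by (auto simp: Hom_def)
  then show ?thesis
    using G.m_assoc[of f "inv\<^bsub>Hom_group C X Y\<^esub> g" g] G.l_inv[of g] G.r_one[of f] G.inv_closed[of g] assms
    by (simp add: Hom_group_def Hdiff_def)
qed

lemma ring_End_ring:
  assumes X: "X \<in> Obj C"
  shows "ring (End_ring C X)"
proof (rule ringI)
  interpret G: comm_group "Hom_group C X X" using X X by (rule Hom_comm_group)
  show "abelian_group (End_ring C X)"
  proof (rule abelian_groupI)
    fix f assume "f \<in> carrier (End_ring C X)"
    then show "\<exists>g \<in> carrier (End_ring C X). g \<oplus>\<^bsub>End_ring C X\<^esub> f = \<zero>\<^bsub>End_ring C X\<^esub>"
      using G.l_inv_ex[of f] by (simp add: End_ring_def Hom_group_def)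
  qed (use G.m_closed G.m_assoc G.m_comm G.l_one G.one_closed in
      \<open>simp_all add: End_ring_def Hom_group_def\<close>)
  show "monoid (End_ring C X)"
    by (rule monoidI) (use X in \<open>auto simp: End_ring_def Hom_def Comp_assoc_Arr\<close>)
qed (simp_all add: End_ring_def Comp_Hadd_left Comp_Hadd_right)

section \<open>The braiding of a unital Leibniz algebra\<close>

lemma unital_Leibniz_Arr:
  assumes "unital_Leibniz_algebra C V br nu"
  shows "V \<in> Obj C" "br \<in> Arr C" "Dom C br = V \<odot> V" "Cod C br = V"
    "nu \<in> Arr C" "Dom C nu = Tunit C" "Cod C nu = V"
  using assms by (auto simp: unital_Leibniz_algebra_def Hom_def)

text \<open>Naturality moves the state across, leaving a symmetry with the unit object, which is the
  identity.\<close>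

lemma Symm_state_left:
  assumes "nu \<in> Hom C (Tunit C) V" "X \<in> Obj C"
  shows "Symm C V X \<cdot> (nu \<boxtimes> Ident C X) = Ident C X \<boxtimes> nu"
  using assms Symm_natural_Arr[of nu "Ident C X"] by (auto simp: Hom_def Symm_unit_left)

lemma Symm_state_right:
  assumes "nu \<in> Hom C (Tunit C) V" "X \<in> Obj C"
  shows "Symm C X V \<cdot> (Ident C X \<boxtimes> nu) = nu \<boxtimes> Ident C X"
  using assms Symm_natural_Arr[of "Ident C X" nu] by (auto simp: Hom_def Symm_unit_right)

lemma sigma_Leibniz_Units:
  assumes L: "unital_Leibniz_algebra C V br nu"
  shows "sigma_Leibniz C V br nu \<in> Units (End_monoid C (V \<odot> V))"
proof -
  note [simp] = unital_Leibniz_Arr[OF L]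
  let ?I = "Ident C V" and ?c = "Symm C V V" and ?t = "nu \<boxtimes> br"
  have nu: "nu \<in> Hom C (Tunit C) V" and bn: "br \<cdot> (?I \<boxtimes> nu) = Hzero C V V"
    using L by (simp_all add: unital_Leibniz_algebra_def)
  interpret E: ring "End_ring C (V \<odot> V)" by (rule ring_End_ring) simp
  \<comment> \<open>Factoring out \<open>br\<close> lets the symmetry move the unit into the right
    slot of the next bracket, where \<open>bn\<close> annihilates it.\<close>
  have "?t = (nu \<boxtimes> ?I) \<cdot> br"
    by (simp add: state_Tarr_Comp[OF nu])
  then have "?c \<cdot> ?t = (?c \<cdot> (nu \<boxtimes> ?I)) \<cdot> br"
    by (simp add: Comp_assoc_Arr del: Ident_Comp_Arr)
  then have "?t \<cdot> (?c \<cdot> ?t) = nu \<boxtimes> ((br \<cdot> (?I \<boxtimes> nu)) \<cdot> br)"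
    by (simp add: Symm_state_left[OF nu] state_Tarr_Comp[OF nu] Comp_assoc_Arr)
  also have "\<dots> = Hzero C (V \<odot> V) (V \<odot> V)"
    unfolding bn using Comp_Hzero_left[of br "V \<odot> V" V V] Tarr_Hzero_right[OF nu, of "V \<odot> V" V]
    by (simp add: Hom_def)
  finally have "sigma_Leibniz C V br nu \<in> Units (End_ring C (V \<odot> V))"
    using E.involution_plus_Units[of ?c ?t] Symm_inverse[of V V]
    by (simp add: End_ring_def sigma_Leibniz_def Hom_def)
  \<comment> \<open>\<open>Units\<close> depends only on carrier, product and unit, which
    \<open>End_ring\<close> and \<open>End_monoid\<close> share.\<close>
  then show ?thesis by (simp add: Units_def End_ring_def End_monoid_def)
qed

lemma unital_Leibniz_YBE:
  assumes L: "unital_Leibniz_algebra C V br nu"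
  defines "s \<equiv> sigma_Leibniz C V br nu"
  shows "(s \<boxtimes> Ident C V) \<cdot> ((Ident C V \<boxtimes> s) \<cdot> (s \<boxtimes> Ident C V)) =
    (Ident C V \<boxtimes> s) \<cdot> ((s \<boxtimes> Ident C V) \<cdot> (Ident C V \<boxtimes> s))"
proof -
  note [simp] = unital_Leibniz_Arr[OF L]
  let ?I = "Ident C V" and ?c = "Symm C V V" and ?t = "nu \<boxtimes> br"
  let ?V3 = "V \<odot> V \<odot> V"
  let ?c1 = "?c \<boxtimes> ?I" and ?c2 = "?I \<boxtimes> ?c" and ?t1 = "?t \<boxtimes> ?I" and ?t2 = "?I \<boxtimes> ?t"
  have nu: "nu \<in> Hom C (Tunit C) V" and br: "br \<in> Hom C (V \<odot> V) V"
    and bn: "br \<cdot> (?I \<boxtimes> nu) = Hzero C V V" and nb: "br \<cdot> (nu \<boxtimes> ?I) = Hzero C V V"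
    and Leibniz: "br \<cdot> (?I \<boxtimes> br) =
      Hdiff C (br \<cdot> (br \<boxtimes> ?I)) (br \<cdot> (br \<boxtimes> ?I) \<cdot> ?c2)"
    using L by (simp_all add: unital_Leibniz_algebra_def)
  have I: "?I \<in> Hom C V V" and c: "?c \<in> Hom C (V \<odot> V) (V \<odot> V)"
    and t: "?t \<in> Hom C (V \<odot> V) (V \<odot> V)" by (simp_all add: Hom_def)
  interpret E: ring "End_ring C ?V3" by (rule ring_End_ring) simp
  have t2_state: "?t2 \<cdot> (nu \<boxtimes> f) = nu \<boxtimes> nu \<boxtimes> (br \<cdot> f)"
    if "f \<in> Arr C" "Cod C f = V \<odot> V" for f
    using that by (subst interchange) (simp_all add: state_Tarr_Comp[OF nu])
  have c_states: "?c \<cdot> (nu \<boxtimes> nu) = nu \<boxtimes> nu"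
    using Symm_natural_Arr[of nu nu] by (simp add: Symm_unit_left)
  have cc: "?c1 \<cdot> ?c1 = Ident C ?V3" "?c2 \<cdot> ?c2 = Ident C ?V3"
    using Symm_inverse[of V V] by (simp_all add: interchange)
  \<comment> \<open>The unit created by \<open>?t2\<close> enters the right slot of the bracket in
    \<open>?t1\<close>.\<close>
  have tt: "?t1 \<cdot> ?t2 = Hzero C ?V3 ?V3"
  proof -
    have "(br \<boxtimes> ?I) \<cdot> ((?I \<boxtimes> nu) \<boxtimes> br) = Hzero C V V \<boxtimes> br"
      by (subst interchange) (simp_all add: bn)
    then show ?thesis
      using Tarr_Hzero_left[OF br, of V V] Tarr_Hzero_right[OF nu, of ?V3 "V \<odot> V"]
      by (simp add: state_Tarr_Comp[OF nu])
  qed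
  have tct: "?t1 \<cdot> (?c2 \<cdot> ?t1) = Hzero C ?V3 ?V3"
  proof -
    have "?c2 \<cdot> ?t1 = nu \<boxtimes> (?c \<cdot> (br \<boxtimes> ?I))"
      by (simp add: interchange)
    \<comment> \<open>Naturality puts the inner bracket behind the other strand, so that the outer
      bracket receives the unit in its left slot and \<open>nb\<close> applies.\<close>
    also have "?c \<cdot> (br \<boxtimes> ?I) = (?I \<boxtimes> br) \<cdot> Symm C (V \<odot> V) V"
      using Symm_natural_Arr[of br ?I] by simp
    also have "nu \<boxtimes> \<dots> = (nu \<boxtimes> ?I \<boxtimes> br) \<cdot> Symm C (V \<odot> V) V"
      by (simp add: state_Tarr_Comp[OF nu])
    finally have "?t1 \<cdot> (?c2 \<cdot> ?t1) =
        nu \<boxtimes> (((br \<boxtimes> ?I) \<cdot> (nu \<boxtimes> ?I \<boxtimes> br)) \<cdot> Symm C (V \<odot> V) V)"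
      by (simp add: state_Tarr_Comp[OF nu] Comp_assoc_Arr)
    also have "(br \<boxtimes> ?I) \<cdot> (nu \<boxtimes> ?I \<boxtimes> br) = Hzero C ?V3 (V \<odot> V)"
    proof -
      have "(br \<boxtimes> ?I) \<cdot> ((nu \<boxtimes> ?I) \<boxtimes> br) = Hzero C V V \<boxtimes> br"
        by (subst interchange) (simp_all add: nb)
      then show ?thesis using Tarr_Hzero_left[OF br, of V V] by simp
    qed
    also have "\<dots> \<cdot> Symm C (V \<odot> V) V = Hzero C ?V3 (V \<odot> V)"
      by (rule Comp_Hzero_left) (simp_all add: Hom_def)
    finally show ?thesis using Tarr_Hzero_right[OF nu, of ?V3 "V \<odot> V"] by simp
  qed
  \<comment> \<open>All three terms have the form \<nu> \<otimes> \<nu> \<otimes> (iterated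
    bracket), which reduces the claim to the Leibniz identity.\<close>
  have ctt: "?c1 \<cdot> (?t2 \<cdot> ?t1) = Hadd C (?t2 \<cdot> (?c1 \<cdot> ?t2)) (?t2 \<cdot> (?t1 \<cdot> ?c2))"
  proof -
    have "?c1 \<cdot> (?t2 \<cdot> ?t1) = ?c1 \<cdot> ((nu \<boxtimes> nu) \<boxtimes> (br \<cdot> (br \<boxtimes> ?I)))"
      by (simp add: t2_state)
    also have "\<dots> = nu \<boxtimes> nu \<boxtimes> (br \<cdot> (br \<boxtimes> ?I))"
      by (subst interchange) (simp_all add: c_states)
    finally have lhs: "?c1 \<cdot> (?t2 \<cdot> ?t1) = nu \<boxtimes> nu \<boxtimes> (br \<cdot> (br \<boxtimes> ?I))" .
    have "?c1 \<cdot> ((?I \<boxtimes> nu) \<boxtimes> br) = nu \<boxtimes> ?I \<boxtimes> br"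
      by (subst interchange) (simp_all add: Symm_state_right[OF nu])
    then have rhs1: "?t2 \<cdot> (?c1 \<cdot> ?t2) = nu \<boxtimes> nu \<boxtimes> (br \<cdot> (?I \<boxtimes> br))"
      by (simp add: t2_state)
    have rhs2: "?t2 \<cdot> (?t1 \<cdot> ?c2) = nu \<boxtimes> nu \<boxtimes> (br \<cdot> (br \<boxtimes> ?I) \<cdot> ?c2)"
      by (simp add: t2_state state_Tarr_Comp[OF nu] Comp_assoc_Arr)
    have b: "br \<cdot> (br \<boxtimes> ?I) \<in> Hom C ?V3 V" "br \<cdot> (br \<boxtimes> ?I) \<cdot> ?c2 \<in> Hom C ?V3 V"
      "br \<cdot> (?I \<boxtimes> br) \<in> Hom C ?V3 V"
      by (simp_all add: Hom_def)
    \<comment> \<open>The Leibniz identity with its subtracted term moved to the other side.\<close>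
    have "br \<cdot> (br \<boxtimes> ?I) = Hadd C (br \<cdot> (?I \<boxtimes> br)) (br \<cdot> (br \<boxtimes> ?I) \<cdot> ?c2)"
      unfolding Leibniz using Hdiff_Hadd[OF b(1,2)] by simp
    then show ?thesis unfolding lhs rhs1 rhs2
      using Tarr_Hadd_right[OF nu b(3,2)]
        Tarr_Hadd_right[OF nu Tarr_Hom[OF nu b(3)] Tarr_Hom[OF nu b(2)]] by metis
  qed
  have "Hadd C ?c1 ?t1 \<cdot> (Hadd C ?c2 ?t2 \<cdot> Hadd C ?c1 ?t1) =
      Hadd C ?c2 ?t2 \<cdot> (Hadd C ?c1 ?t1 \<cdot> Hadd C ?c2 ?t2)"
    using E.sum_braid_relation[of ?c1 ?c2 ?t1 ?t2] cc tt tct ctt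
      Symm_mixed_relation[OF _ c] Symm_mixed_relation[OF _ t]
    by (simp add: End_ring_def Hom_def)
  \<comment> \<open>By bilinearity the sums are \<open>s \<boxtimes> ?I\<close> and
    \<open>?I \<boxtimes> s\<close>.\<close>
  then show ?thesis
    using Tarr_Hadd_left[OF c t I] Tarr_Hadd_right[OF I c t] by (simp add: s_def sigma_Leibniz_def)
qed

end

theorem proposition3p35:
  fixes C :: "('o, 'm) symmetric_data" and V :: 'o and mu nu :: 'm
    and D :: "('p, 'k) preadditive_data" and W :: 'p and br eta :: 'k
  shows "(symmetric_category C \<and> unital_associative_algebra C V mu nu \<longrightarrow>
            defines_VB_monoid_action C V (Symm C V V) (sigma_assoc C mu nu)) \<and>
         (symmetric_preadditive_category D \<and> unital_Leibniz_algebra D W br eta \<longrightarrow>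
            defines_VB_group_action D W (Symm D W W) (sigma_Leibniz D W br eta))"
proof (intro conjI impI; elim conjE)
  assume "symmetric_category C" and A: "unital_associative_algebra C V mu nu"
  then interpret symmetric_category C by simp
  have V: "V \<in> Obj C" and "mu \<in> Hom C (V \<odot>\<^bsub>C\<^esub> V) V" "nu \<in> Hom C (Tunit C) V"
    using A by (simp_all add: unital_associative_algebra_def)
  then have "sigma_assoc C mu nu \<in> Hom C (V \<odot>\<^bsub>C\<^esub> V) (V \<odot>\<^bsub>C\<^esub> V)"
    by (auto simp: sigma_assoc_def Hom_def)
  then show "defines_VB_monoid_action C V (Symm C V V) (sigma_assoc C mu nu)"
    using V A by (intro defines_VB_monoid_action_YBE unital_associative_YBE)
next
  assume "symmetric_preadditive_category D" and L: "unital_Leibniz_algebra D W br eta"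
  then interpret symmetric_preadditive_category D by simp
  show "defines_VB_group_action D W (Symm D W W) (sigma_Leibniz D W br eta)"
    using L by (intro defines_VB_group_action_YBE unital_Leibniz_Arr(1) sigma_Leibniz_Units
        unital_Leibniz_YBE)
qed

end
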